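(* Let $(\mathcal{C},\Omega,\mathfrak{P})$ be a measurable spined category. Then the triangulation functor $\Delta$ and the chordal triangulation functor $\Delta^{ch}$ of $(\mathcal{C},\Omega,\mathfrak{P})$ are both S-functors over $(\mathcal{C},\Omega,\mathfrak{P})$; that is, $\Delta(\Omega_n)=n=\Delta^{ch}(\Omega_n)$ for all $n\in\mathbb{N}$, and for every span $A \xleftarrow{a} \Omega_n \xrightarrow{b} B$ in $\mathcal{C}$ we have $\Delta(\mathfrak{P}(a,b))=\max\{\Delta(A),\Delta(B)\}$ and $\Delta^{ch}(\mathfrak{P}(a,b))=\max\{\Delta^{ch}(A),\Delta^{ch}(B)\}$.
   Context: $\mathbb{N}=\{0,1,2,\dots\}$. A spined category is a triple $(\mathcal{C},\Omega,\mathfrak{P})$ where $\mathcal{C}$ is a category, $\Omega=(\Omega_n)_{n\in\mathbb{N}}$ is a sequence of objects of $\mathcal{C}$ (the spine), and $\mathfrak{P}$ (the proxy pushout) assigns to each span $G\xleftarrow{g}\Omega_n\xrightarrow{h}H$ in $\mathcal{C}$ an object $\mathfrak{P}(g,h)$ together with morphisms $\mathfrak{P}(g,h)_g:G\to\mathfrak{P}(g,h)$ and $\mathfrak{P}(g,h)_h:H\to\mathfrak{P}(g,h)$ with $\mathfrak{P}(g,h)_g\circ g=\mathfrak{P}(g,h)_h\circ h$, such that (SC1) for every object $X$ there are $n\in\mathbb{N}$ and a morphism $X\to\Omega_n$; (SC2) for every such span and all morphisms $g':G\to G'$, $h':H\to H'$ there is a unique morphism $(g',h'):\mathfrak{P}(g,h)\to\mathfrak{P}(g'\circ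 g,h'\circ h)$ with $(g',h')\circ\mathfrak{P}(g,h)_g=\mathfrak{P}(g'g,h'h)_{g'g}\circ g'$ and $(g',h')\circ\mathfrak{P}(g,h)_h=\mathfrak{P}(g'g,h'h)_{h'h}\circ h'$. An S-functor over a spined category $(\mathcal{C},\Omega,\mathfrak{P})$ is a functor $F$ from $\mathcal{C}$ to the poset $(\mathbb{N},\le)$ (viewed as a category) such that $F(\Omega_n)=n$ for all $n$ and $F(\mathfrak{P}(g,h))=\max\{F(G),F(H)\}$ for every span $G\xleftarrow{g}\Omega_n\xrightarrow{h}H$ (i.e. a spine- and proxy-pushout-preserving functor to the spined category $(\mathbb{N}_\le, n\mapsto n, \max)$). The spined category is measurable if it admits at least one S-functor. An object $X$ is pseudo-chordal if $F(X)=G(X)$ for all S-functors $F,G$. The set of chordal objects is the smallest set $S$ of objects containing every $\Omega_n$ and containing $\mathfrak{P}(a,b)$ whenever $A,B\in S$ and $a:\Omega_n\to A$, $b:\Omega_n\to B$. A pseudo-chordal (resp. chordal) completion of $X$ is a morphism $\delta:X\to H$ with $H$ pseudo-chordal (resp. chordal); its width is $F(H)$ for any S-functor $F$ (independent of $F$). In a measurable spined category, $\Delta(X)$ (the triangulation functor) is the minimum width of a pseudo-chordal completion of $X$, and $\Delta^{ch}(X)$ (the chordal triangulation functor) is the minimum width of a chordal completion of $X$; on morphisms they act as the unique arrows of the poset $(\mathbb{N},\le)$. *)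

theory Defs
  imports Main
begin

record ('o, 'a) cat =
  Obj :: "'o set"
  Arr :: "'a set"
  Dom :: "'a \<Rightarrow> 'o"
  Cod :: "'a \<Rightarrow> 'o"
  Ident :: "'o \<Rightarrow> 'a"
  Comp :: "'a \<Rightarrow> 'a \<Rightarrow> 'a" (infixl \<open>\<cdot>\<index>\<close> 70)

definition Hom :: "('o, 'a, 'm) cat_scheme \<Rightarrow> 'o \<Rightarrow> 'o \<Rightarrow> 'a set" where
  "Hom C X Y = {f \<in> Arr C. Dom C f = X \<and> Cod C f = Y}"

locale category =
  fixes C :: "('o, 'a, 'm) cat_scheme" (structure)
  assumes Dom_in_Obj: "f \<in> Arr C \<Longrightarrow> Dom C f \<in> Obj C"
    and Cod_in_Obj: "f \<in> Arr C \<Longrightarrow> Cod C f \<in> Obj C"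
    and Ident_in_Hom: "X \<in> Obj C \<Longrightarrow> Ident C X \<in> Hom C X X"
    and Comp_in_Hom: "f \<in> Hom C X Y \<Longrightarrow> g \<in> Hom C Y Z \<Longrightarrow> g \<cdot> f \<in> Hom C X Z"
    and Comp_Ident: "f \<in> Hom C X Y \<Longrightarrow> f \<cdot> Ident C X = f"
    and Ident_Comp: "f \<in> Hom C X Y \<Longrightarrow> Ident C Y \<cdot> f = f"
    and Comp_assoc:
      "f \<in> Hom C W X \<Longrightarrow> g \<in> Hom C X Y \<Longrightarrow> h \<in> Hom C Y Z \<Longrightarrow> (h \<cdot> g) \<cdot> f = h \<cdot> (g \<cdot> f)"

record ('o, 'a, 'p, 'b) cat_map =
  on_obj :: "'o \<Rightarrow> 'p"
  on_arr :: "'a \<Rightarrow> 'b"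

locale cat_functor = source: category C + target: category D
  for C :: "('o, 'a, 'm) cat_scheme" and D :: "('p, 'b, 'n) cat_scheme" +
  fixes F :: "('o, 'a, 'p, 'b) cat_map"
  assumes on_obj_in_Obj: "X \<in> Obj C \<Longrightarrow> on_obj F X \<in> Obj D"
    and on_arr_in_Hom: "f \<in> Hom C X Y \<Longrightarrow> on_arr F f \<in> Hom D (on_obj F X) (on_obj F Y)"
    and on_arr_Ident: "X \<in> Obj C \<Longrightarrow> on_arr F (Ident C X) = Ident D (on_obj F X)"
    and on_arr_Comp: "f \<in> Hom C X Y \<Longrightarrow> g \<in> Hom C Y Z \<Longrightarrow>
      on_arr F (g \<cdot>\<^bsub>C\<^esub> f) = on_arr F g \<cdot>\<^bsub>D\<^esub> on_arr F f"

text \<open>The poset of natural numbers as a category: the unique arrow from \<open>m\<close> to \<open>n\<close>,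
  for \<open>m \<le> n\<close>, is the pair \<open>(m, n)\<close>.\<close>

definition nat_le_cat :: "(nat, nat \<times> nat) cat" where
  "nat_le_cat = \<lparr>Obj = UNIV, Arr = {(m, n). m \<le> n}, Dom = fst, Cod = snd,
     Ident = (\<lambda>n. (n, n)), Comp = (\<lambda>g f. (fst f, snd g))\<rparr>"

text \<open>A span is represented by its two legs \<open>g\<close> and \<open>h\<close>, which determine its feet and its apex.
  \<open>Pleg1 S g h\<close> and \<open>Pleg2 S g h\<close> are the morphisms of the proxy pushout \<open>PP S g h\<close> out of
  the codomains of \<open>g\<close> and \<open>h\<close> respectively.\<close>

record ('o, 'a) spined_cat = "('o, 'a) cat" +
  Spine :: "nat \<Rightarrow> 'o" (\<open>\<Omega>\<index>\<close>)
  PP :: "'a \<Rightarrow> 'a \<Rightarrow> 'o"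
  Pleg1 :: "'a \<Rightarrow> 'a \<Rightarrow> 'a"
  Pleg2 :: "'a \<Rightarrow> 'a \<Rightarrow> 'a"

locale spined_category = category S
  for S :: "('o, 'a, 'm) spined_cat_scheme" (structure) +
  assumes Spine_in_Obj: "\<Omega> n \<in> Obj S"
    and PP_in_Obj: "g \<in> Hom S (\<Omega> n) G \<Longrightarrow> h \<in> Hom S (\<Omega> n) H \<Longrightarrow> PP S g h \<in> Obj S"
    and Pleg1_in_Hom:
      "g \<in> Hom S (\<Omega> n) G \<Longrightarrow> h \<in> Hom S (\<Omega> n) H \<Longrightarrow> Pleg1 S g h \<in> Hom S G (PP S g h)"
    and Pleg2_in_Hom:
      "g \<in> Hom S (\<Omega> n) G \<Longrightarrow> h \<in> Hom S (\<Omega> n) H \<Longrightarrow> Pleg2 S g h \<in> Hom S H (PP S g h)"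
    and PP_commutes:
      "g \<in> Hom S (\<Omega> n) G \<Longrightarrow> h \<in> Hom S (\<Omega> n) H \<Longrightarrow> Pleg1 S g h \<cdot> g = Pleg2 S g h \<cdot> h"
    and SC1: "X \<in> Obj S \<Longrightarrow> \<exists>n. Hom S X (\<Omega> n) \<noteq> {}"
    and SC2: "g \<in> Hom S (\<Omega> n) G \<Longrightarrow> h \<in> Hom S (\<Omega> n) H \<Longrightarrow>
      g' \<in> Hom S G G' \<Longrightarrow> h' \<in> Hom S H H' \<Longrightarrow>
      \<exists>!u. u \<in> Hom S (PP S g h) (PP S (g' \<cdot> g) (h' \<cdot> h)) \<and>
        u \<cdot> Pleg1 S g h = Pleg1 S (g' \<cdot> g) (h' \<cdot> h) \<cdot> g' \<and>
        u \<cdot> Pleg2 S g h = Pleg2 S (g' \<cdot> g) (h' \<cdot> h) \<cdot> h'"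

type_synonym ('o, 'a) nat_functor = "('o, 'a, nat, nat \<times> nat) cat_map"

definition S_functor :: "('o, 'a, 'm) spined_cat_scheme \<Rightarrow> ('o, 'a) nat_functor \<Rightarrow> bool" where
  "S_functor S F \<longleftrightarrow> cat_functor S nat_le_cat F \<and>
     (\<forall>n. on_obj F (Spine S n) = n) \<and>
     (\<forall>n G H. \<forall>g \<in> Hom S (Spine S n) G. \<forall>h \<in> Hom S (Spine S n) H.
        on_obj F (PP S g h) = max (on_obj F G) (on_obj F H))"

locale measurable_spined_category = spined_category +
  assumes measurable: "\<exists>F. S_functor S F"

definition pseudo_chordal :: "('o, 'a, 'm) spined_cat_scheme \<Rightarrow> 'o set" where
  "pseudo_chordal S =
     {X \<in> Obj S. \<forall>F G. S_functor S F \<longrightarrow> S_functor S G \<longrightarrow> on_obj F X = on_obj G X}"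

inductive_set chordal :: "('o, 'a, 'm) spined_cat_scheme \<Rightarrow> 'o set"
  for S :: "('o, 'a, 'm) spined_cat_scheme" where
  Spine_chordal: "Spine S n \<in> chordal S"
| PP_chordal: "A \<in> chordal S \<Longrightarrow> B \<in> chordal S \<Longrightarrow>
    a \<in> Hom S (Spine S n) A \<Longrightarrow> b \<in> Hom S (Spine S n) B \<Longrightarrow> PP S a b \<in> chordal S"

definition pseudo_chordal_completion ::
    "('o, 'a, 'm) spined_cat_scheme \<Rightarrow> 'o \<Rightarrow> 'a \<Rightarrow> bool" where
  "pseudo_chordal_completion S X \<delta> \<longleftrightarrow> (\<exists>H \<in> pseudo_chordal S. \<delta> \<in> Hom S X H)"

definition chordal_completion ::
    "('o, 'a, 'm) spined_cat_scheme \<Rightarrow> 'o \<Rightarrow> 'a \<Rightarrow> bool" where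
  "chordal_completion S X \<delta> \<longleftrightarrow> (\<exists>H \<in> chordal S. \<delta> \<in> Hom S X H)"

text \<open>Meaningful only when an S-functor exists and all S-functors agree on the codomain
  of \<open>\<delta>\<close>.\<close>

definition width :: "('o, 'a, 'm) spined_cat_scheme \<Rightarrow> 'a \<Rightarrow> nat" where
  "width S \<delta> = (THE w. \<forall>F. S_functor S F \<longrightarrow> on_obj F (Cod S \<delta>) = w)"

definition min_pseudo_chordal_width :: "('o, 'a, 'm) spined_cat_scheme \<Rightarrow> 'o \<Rightarrow> nat" where
  "min_pseudo_chordal_width S X =
     (LEAST w. \<exists>\<delta>. pseudo_chordal_completion S X \<delta> \<and> width S \<delta> = w)"

definition min_chordal_width :: "('o, 'a, 'm) spined_cat_scheme \<Rightarrow> 'o \<Rightarrow> nat" where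
  "min_chordal_width S X = (LEAST w. \<exists>\<delta>. chordal_completion S X \<delta> \<and> width S \<delta> = w)"

definition triangulation :: "('o, 'a, 'm) spined_cat_scheme \<Rightarrow> ('o, 'a) nat_functor" where
  "triangulation S = \<lparr>on_obj = min_pseudo_chordal_width S,
     on_arr = (\<lambda>f. (min_pseudo_chordal_width S (Dom S f), min_pseudo_chordal_width S (Cod S f)))\<rparr>"

definition chordal_triangulation ::
    "('o, 'a, 'm) spined_cat_scheme \<Rightarrow> ('o, 'a) nat_functor" where
  "chordal_triangulation S = \<lparr>on_obj = min_chordal_width S,
     on_arr = (\<lambda>f. (min_chordal_width S (Dom S f), min_chordal_width S (Cod S f)))\<rparr>"

end

theory Submission
  imports Defs
begin

text \<open>
  Both triangulation functors are instances of one construction: fix a class \<open>K\<close> of pseudo-chordal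
  objects that contains the spine and is closed under proxy pushouts, and send \<open>X\<close> to the least
  width of a morphism from \<open>X\<close> into \<open>K\<close>. Precomposition makes this monotone. Any S-functor \<open>F\<close>
  satisfies \<open>n = F (\<Omega> n) \<le> F H\<close> whenever there is a morphism \<open>\<Omega> n \<rightarrow> H\<close>, so the identity of
  \<open>\<Omega> n\<close> is an optimal completion. Optimal completions of \<open>A\<close> and \<open>B\<close> are glued by SC2 to a
  completion of \<open>PP a b\<close> whose width is the maximum of the two; the legs \<open>A \<rightarrow> PP a b \<leftarrow> B\<close> give
  the converse inequality.
\<close>

lemma category_nat_le_cat: "category nat_le_cat"
  by unfold_locales (auto simp: nat_le_cat_def Hom_def)

lemma S_functor_Spine:
  "S_functor S F \<Longrightarrow> on_obj F (Spine S n) = n"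
  by (simp add: S_functor_def)

lemma S_functor_PP:
  assumes "S_functor S F" "g \<in> Hom S (Spine S n) G" "h \<in> Hom S (Spine S n) H"
  shows "on_obj F (PP S g h) = max (on_obj F G) (on_obj F H)"
  using assms unfolding S_functor_def by blast

lemma S_functor_mono:
  assumes "S_functor S F" "f \<in> Hom S X Y"
  shows "on_obj F X \<le> on_obj F Y"
proof -
  interpret cat_functor S nat_le_cat F
    using assms(1) by (simp add: S_functor_def)
  show ?thesis
    using on_arr_in_Hom[OF assms(2)] by (auto simp: Hom_def nat_le_cat_def)
qed

text \<open>Pseudo-chordality makes all S-functors agree on \<open>H\<close>, and \<open>F\<close>
  witnesses that there is one, so the \<open>THE\<close> in \<open>width\<close> has exactly one
  candidate.\<close>

lemma width_eq:
  assumes "S_functor S F" "H \<in> pseudo_chordal S" "\<delta> \<in> Hom S X H"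
  shows "width S \<delta> = on_obj F H"
proof -
  have Cod: "Cod S \<delta> = H"
    using assms(3) by (simp add: Hom_def)
  have "\<forall>G. S_functor S G \<longrightarrow> on_obj G H = on_obj F H"
    using assms(1,2) unfolding pseudo_chordal_def by blast
  then show ?thesis
    unfolding width_def Cod using assms(1) by (intro the_equality) blast+
qed

context spined_category
begin

lemma Spine_in_pseudo_chordal: "\<Omega> n \<in> pseudo_chordal S"
  by (simp add: pseudo_chordal_def Spine_in_Obj S_functor_Spine)

text \<open>An S-functor's value at \<open>PP S a b\<close> is fixed by its values at the feet, so
  agreement at \<open>A\<close> and \<open>B\<close> passes on to the proxy pushout.\<close>

lemma PP_in_pseudo_chordal:
  assumes "A \<in> pseudo_chordal S" "B \<in> pseudo_chordal S"
    and "a \<in> Hom S (\<Omega> n) A" "b \<in> Hom S (\<Omega> n) B"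
  shows "PP S a b \<in> pseudo_chordal S"
proof -
  have "on_obj F (PP S a b) = on_obj G (PP S a b)"
    if F: "S_functor S F" and G: "S_functor S G" for F G
  proof -
    have "on_obj F A = on_obj G A" "on_obj F B = on_obj G B"
      using assms(1,2) F G unfolding pseudo_chordal_def by blast+
    then show ?thesis
      by (simp add: S_functor_PP[OF F assms(3,4)] S_functor_PP[OF G assms(3,4)])
  qed
  then show ?thesis
    using PP_in_Obj[OF assms(3,4)] unfolding pseudo_chordal_def by blast
qed

lemma chordal_subset_pseudo_chordal: "chordal S \<subseteq> pseudo_chordal S"
proof
  fix X
  assume "X \<in> chordal S"
  then show "X \<in> pseudo_chordal S"
  proof induction
    case (Spine_chordal n)
    show ?case
      by (rule Spine_in_pseudo_chordal)
  next
    case (PP_chordal A B a n b)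
    show ?case
      using PP_chordal.IH PP_chordal.hyps(3,4) by (rule PP_in_pseudo_chordal)
  qed
qed

end

text \<open>Here \<open>'a\<close> is the type of objects, as
  \<open>K \<subseteq> pseudo_chordal S\<close> forces, and not that of arrows as in the records
  above.\<close>

locale completion_class = measurable_spined_category +
  fixes K :: "'a set"
  assumes K_pseudo_chordal: "K \<subseteq> pseudo_chordal S"
    and Spine_in_K: "\<Omega> n \<in> K"
    and PP_in_K: "A \<in> K \<Longrightarrow> B \<in> K \<Longrightarrow> a \<in> Hom S (\<Omega> n) A \<Longrightarrow> b \<in> Hom S (\<Omega> n) B \<Longrightarrow> PP S a b \<in> K"
begin

definition min_width :: "'a \<Rightarrow> nat" where
  "min_width X = (LEAST w. \<exists>\<delta>. (\<exists>H \<in> K. \<delta> \<in> Hom S X H) \<and> width S \<delta> = w)"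

lemma min_width_le:
  assumes "S_functor S F" "H \<in> K" "\<delta> \<in> Hom S X H"
  shows "min_width X \<le> on_obj F H"
proof -
  have "width S \<delta> = on_obj F H"
    using assms K_pseudo_chordal by (blast intro: width_eq)
  then show ?thesis
    unfolding min_width_def using assms(2,3) by (blast intro: Least_le)
qed

text \<open>The minimum is attained, and its value can be read off through any chosen
  \<open>F\<close>; later comparisons evaluate all completions with one and the same
  S-functor.\<close>

lemma obtain_optimal_completion:
  assumes "S_functor S F" "X \<in> Obj S"
  obtains H \<delta> where "H \<in> K" "\<delta> \<in> Hom S X H" "min_width X = on_obj F H"
proof -
  \<comment> \<open>SC1 maps \<open>X\<close> into the spine, hence into \<open>K\<close>, so the
    set of widths under \<open>LEAST\<close> is nonempty.\<close>
  obtain n \<delta>\<^sub>0 where "\<delta>\<^sub>0 \<in> Hom S X (\<Omega> n)"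
    using SC1[OF assms(2)] by blast
  then have "\<exists>w \<delta>. (\<exists>H \<in> K. \<delta> \<in> Hom S X H) \<and> width S \<delta> = w"
    using Spine_in_K by blast
  then have "\<exists>\<delta>. (\<exists>H \<in> K. \<delta> \<in> Hom S X H) \<and> width S \<delta> = min_width X"
    unfolding min_width_def by (rule LeastI_ex)
  then obtain H \<delta> where H: "H \<in> K" "\<delta> \<in> Hom S X H" "width S \<delta> = min_width X"
    by blast
  moreover have "width S \<delta> = on_obj F H"
    using H assms(1) K_pseudo_chordal by (blast intro: width_eq)
  ultimately show thesis
    using that by simp
qed

lemma min_width_mono:
  assumes "f \<in> Hom S X Y"
  shows "min_width X \<le> min_width Y"
proof -
  obtain F where F: "S_functor S F"
    using measurable by blast
  have "Y \<in> Obj S"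
    using assms Cod_in_Obj by (auto simp: Hom_def)
  then obtain H \<delta> where H: "H \<in> K" "\<delta> \<in> Hom S Y H" "min_width Y = on_obj F H"
    using obtain_optimal_completion[OF F] by blast
  show ?thesis
    using min_width_le[OF F H(1) Comp_in_Hom[OF assms H(2)]] H(3) by simp
qed

lemma min_width_Spine: "min_width (\<Omega> n) = n"
proof -
  obtain F where F: "S_functor S F"
    using measurable by blast
  obtain H \<delta> where H: "H \<in> K" "\<delta> \<in> Hom S (\<Omega> n) H" "min_width (\<Omega> n) = on_obj F H"
    using obtain_optimal_completion[OF F Spine_in_Obj] by blast
  have "n \<le> min_width (\<Omega> n)"
    using S_functor_mono[OF F H(2)] H(3) by (simp add: S_functor_Spine[OF F])
  moreover have "min_width (\<Omega> n) \<le> n"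
    using min_width_le[OF F Spine_in_K Ident_in_Hom[OF Spine_in_Obj]]
    by (simp add: S_functor_Spine[OF F])
  ultimately show ?thesis
    by simp
qed

lemma min_width_PP:
  assumes a: "a \<in> Hom S (\<Omega> n) A" and b: "b \<in> Hom S (\<Omega> n) B"
  shows "min_width (PP S a b) = max (min_width A) (min_width B)"
proof (rule antisym)
  obtain F where F: "S_functor S F"
    using measurable by blast
  have "A \<in> Obj S" "B \<in> Obj S"
    using a b Cod_in_Obj by (auto simp: Hom_def)
  then obtain H \<delta> J \<epsilon> where
    H: "H \<in> K" "\<delta> \<in> Hom S A H" "min_width A = on_obj F H" and
    J: "J \<in> K" "\<epsilon> \<in> Hom S B J" "min_width B = on_obj F J"
    using obtain_optimal_completion[OF F] by metis
  \<comment> \<open>The composite legs end in \<open>H\<close> and \<open>J\<close>, so their proxy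
    pushout lies in \<open>K\<close> and \<open>F\<close> sends it to the maximum of the two optimal
    widths.\<close>
  note legs = Comp_in_Hom[OF a H(2)] Comp_in_Hom[OF b J(2)]
  obtain u where "u \<in> Hom S (PP S a b) (PP S (\<delta> \<cdot> a) (\<epsilon> \<cdot> b))"
    using SC2[OF a b H(2) J(2)] by blast
  then have "min_width (PP S a b) \<le> on_obj F (PP S (\<delta> \<cdot> a) (\<epsilon> \<cdot> b))"
    using min_width_le[OF F] PP_in_K[OF H(1) J(1) legs] by blast
  then show "min_width (PP S a b) \<le> max (min_width A) (min_width B)"
    by (simp add: S_functor_PP[OF F legs] H(3) J(3))
  show "max (min_width A) (min_width B) \<le> min_width (PP S a b)"
    using min_width_mono[OF Pleg1_in_Hom[OF a b]] min_width_mono[OF Pleg2_in_Hom[OF a b]] by simp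
qed

lemma S_functor_min_width:
  "S_functor S \<lparr>on_obj = min_width, on_arr = (\<lambda>f. (min_width (Dom S f), min_width (Cod S f)))\<rparr>"
  (is "S_functor S ?F")
proof -
  interpret N: category nat_le_cat
    by (rule category_nat_le_cat)
  \<comment> \<open>Arrows of the poset are pairs of endpoints, so identities and composites are
    preserved by construction; the real content is monotonicity.\<close>
  have "cat_functor S nat_le_cat ?F"
  proof
    fix X Y f
    assume "f \<in> Hom S X Y"
    then show "on_arr ?F f \<in> Hom nat_le_cat (on_obj ?F X) (on_obj ?F Y)"
      using min_width_mono[of f X Y] by (auto simp: Hom_def nat_le_cat_def)
  next
    fix X
    assume "X \<in> Obj S"
    then show "on_arr ?F (Ident S X) = Ident nat_le_cat (on_obj ?F X)"
      using Ident_in_Hom[of X] by (auto simp: Hom_def nat_le_cat_def)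
  next
    fix X Y Z f g
    assume "f \<in> Hom S X Y" "g \<in> Hom S Y Z"
    then show "on_arr ?F (g \<cdot> f) = on_arr ?F g \<cdot>\<^bsub>nat_le_cat\<^esub> on_arr ?F f"
      using Comp_in_Hom[of f X Y g Z] by (auto simp: Hom_def nat_le_cat_def)
  qed (simp add: nat_le_cat_def)
  then show ?thesis
    by (simp add: S_functor_def min_width_Spine min_width_PP)
qed

end

context measurable_spined_category
begin

text \<open>This is the largest class \<open>K\<close> that the locale admits.\<close>

lemma S_functor_triangulation: "S_functor S (triangulation S)"
proof -
  interpret completion_class S "pseudo_chordal S"
    by unfold_locales (rule subset_refl Spine_in_pseudo_chordal PP_in_pseudo_chordal; assumption?)+
  have "min_pseudo_chordal_width S = min_width"
    by (simp add: fun_eq_iff min_width_def min_pseudo_chordal_width_def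
        pseudo_chordal_completion_def)
  then show ?thesis
    using S_functor_min_width by (simp add: triangulation_def)
qed

text \<open>This is the smallest admissible \<open>K\<close>: the two closure conditions of the
  locale are the introduction rules of \<open>chordal\<close>.\<close>

lemma S_functor_chordal_triangulation: "S_functor S (chordal_triangulation S)"
proof -
  interpret completion_class S "chordal S"
    by unfold_locales
      (rule chordal_subset_pseudo_chordal Spine_chordal PP_chordal; assumption?)+
  have "min_chordal_width S = min_width"
    by (simp add: fun_eq_iff min_width_def min_chordal_width_def chordal_completion_def)
  then show ?thesis
    using S_functor_min_width by (simp add: chordal_triangulation_def)
qed

end

theorem theorem4p10:
  fixes S :: "('o, 'a, 'm) spined_cat_scheme"
  assumes "measurable_spined_category S"
  shows "S_functor S (triangulation S) \<and> S_functor S (chordal_triangulation S) \<and>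
    (\<forall>n. on_obj (triangulation S) (Spine S n) = n \<and>
         on_obj (chordal_triangulation S) (Spine S n) = n) \<and>
    (\<forall>n A B. \<forall>a \<in> Hom S (Spine S n) A. \<forall>b \<in> Hom S (Spine S n) B.
       on_obj (triangulation S) (PP S a b) =
         max (on_obj (triangulation S) A) (on_obj (triangulation S) B) \<and>
       on_obj (chordal_triangulation S) (PP S a b) =
         max (on_obj (chordal_triangulation S) A) (on_obj (chordal_triangulation S) B))"
proof -
  interpret measurable_spined_category S
    by (rule assms)
  show ?thesis
    using S_functor_triangulation S_functor_chordal_triangulation
    by (simp add: S_functor_Spine S_functor_PP)
qed

end
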